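(* Let $f,-g,h_1,\ldots,h_m:\mathbb{R}^n\to\mathbb{R}$ be convex polynomials and let $K:=\{x\in\mathbb{R}^n\mid h_i(x)\le 0,\ i=1,\ldots,m\}$. Assume that $K$ is nonempty and that $f(x)\ge 0$ and $g(x)>0$ for every $x\in K$. If the Slater condition holds, i.e., there exists a point $\hat{x}\in\mathbb{R}^n$ such that $h_i(\hat{x})<0$ for all $i=1,\ldots,m$, then $$\inf\,(\mathrm{P}_{\rm CCT})=\max\,(\mathrm{LD}),$$ where $\max$ means that the supremum in (LD) is attained.
   Context: (P$_{\rm CCT}$) is the problem, in the variables $(s,t)\in\mathbb{R}^n\times\mathbb{R}$: minimize $t\,f(s/t)$ subject to $t\,h_i(s/t)\le 0$ for $i=1,\ldots,m$, $\;1-t\,g(s/t)\le 0$, and $t>0$. It is the Charnes--Cooper reformulation of the fractional program $\inf_{x\in K} f(x)/g(x)$. (LD) is its Lagrange dual, in the variables $\lambda\in\mathbb{R}^m$, $\gamma\in\mathbb{R}$: maximize $\gamma$ subject to $f(x)+\sum_{i=1}^m\lambda_i h_i(x)-\gamma g(x)\ge 0$ for all $x\in\mathbb{R}^n$, $\;\lambda_i\ge 0$ for $i=1,\ldots,m$, and $\gamma\ge 0$. *)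

theory Defs
  imports "HOL-Analysis.Analysis"
begin

definition convex_polynomial :: "(real ^ 'n \<Rightarrow> real) \<Rightarrow> bool" where
  "convex_polynomial p \<longleftrightarrow> real_polynomial_function p \<and> convex_on UNIV p"

text \<open>
  The constraint functions are a family \<open>h :: nat \<Rightarrow> real ^ 'n \<Rightarrow> real\<close> of which only
  the members with index in \<open>{1..m}\<close> are used; \<open>m = 0\<close> is allowed.
\<close>

definition constraint_set :: "nat \<Rightarrow> (nat \<Rightarrow> real ^ 'n \<Rightarrow> real) \<Rightarrow> (real ^ 'n) set" where
  "constraint_set m h = {x. \<forall>i\<in>{1..m}. h i x \<le> 0}"

definition slater_condition :: "nat \<Rightarrow> (nat \<Rightarrow> real ^ 'n \<Rightarrow> real) \<Rightarrow> bool" where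
  "slater_condition m h \<longleftrightarrow> (\<exists>x. \<forall>i\<in>{1..m}. h i x < 0)"

definition CCT_feasible ::
    "nat \<Rightarrow> (real ^ 'n \<Rightarrow> real) \<Rightarrow> (nat \<Rightarrow> real ^ 'n \<Rightarrow> real) \<Rightarrow> ((real ^ 'n) \<times> real) set" where
  "CCT_feasible m g h =
     {(s, t). (\<forall>i\<in>{1..m}. t * h i (s /\<^sub>R t) \<le> 0) \<and> 1 - t * g (s /\<^sub>R t) \<le> 0 \<and> t > 0}"

text \<open>
  Optimal values are extended reals, so that the infimum of an unbounded problem and the
  supremum of an infeasible one have their usual meaning.
\<close>

definition CCT_inf ::
    "nat \<Rightarrow> (real ^ 'n \<Rightarrow> real) \<Rightarrow> (real ^ 'n \<Rightarrow> real) \<Rightarrow> (nat \<Rightarrow> real ^ 'n \<Rightarrow> real) \<Rightarrow> ereal" where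
  "CCT_inf m f g h = (INF (s, t)\<in>CCT_feasible m g h. ereal (t * f (s /\<^sub>R t)))"

text \<open>A multiplier in \<open>\<real>\<^sup>m\<close> is a function on \<open>{1..m}\<close>, extended by \<open>undefined\<close>.\<close>

definition LD_feasible ::
    "nat \<Rightarrow> (real ^ 'n \<Rightarrow> real) \<Rightarrow> (real ^ 'n \<Rightarrow> real) \<Rightarrow> (nat \<Rightarrow> real ^ 'n \<Rightarrow> real)
      \<Rightarrow> ((nat \<Rightarrow> real) \<times> real) set" where
  "LD_feasible m f g h =
     {(l, \<gamma>). l \<in> extensional {1..m} \<and>
        (\<forall>x. f x + (\<Sum>i=1..m. l i * h i x) - \<gamma> * g x \<ge> 0) \<and>
        (\<forall>i\<in>{1..m}. l i \<ge> 0) \<and> \<gamma> \<ge> 0}"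

definition LD_sup ::
    "nat \<Rightarrow> (real ^ 'n \<Rightarrow> real) \<Rightarrow> (real ^ 'n \<Rightarrow> real) \<Rightarrow> (nat \<Rightarrow> real ^ 'n \<Rightarrow> real) \<Rightarrow> ereal" where
  "LD_sup m f g h = (SUP (l, \<gamma>)\<in>LD_feasible m f g h. ereal \<gamma>)"

end

theory Submission imports Defs begin

text \<open>
  Both optimal values equal the value of the fractional program
  \<open>\<gamma>\<^sub>0 = Inf {f x / g x | x \<in> K}\<close>, where \<open>K\<close> is the constraint set.
  On the primal side the substitution \<open>x = s / t\<close> turns the objective into \<open>t * f x\<close>
  with \<open>x \<in> K\<close> and \<open>t \<ge> 1 / g x\<close>; as \<open>f x \<ge> 0\<close>, the best choice is \<open>t = 1 / g x\<close>.

  On the dual side, a feasible \<open>(l, \<gamma>)\<close> evaluated at a point of \<open>K\<close> gives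
  \<open>f x - \<gamma> * g x \<ge> 0\<close>, hence \<open>\<gamma> \<le> \<gamma>\<^sub>0\<close>. That \<open>\<gamma>\<^sub>0\<close> itself is attained is the
  strong duality theorem applied to \<open>f - \<gamma>\<^sub>0 * g\<close>, which is convex because \<open>\<gamma>\<^sub>0 \<ge> 0\<close>
  and is nonnegative on \<open>K\<close> by the choice of \<open>\<gamma>\<^sub>0\<close>.

  Strong duality is proved without separating hyperplanes. For one constraint,
  multipliers are the numbers between two families of slopes, and convexity on a segment
  crossing the boundary \<open>h = 0\<close> shows that the families do not overlap
  (\<open>convex_multiplier_single\<close>). For several constraints, the multipliers are found one at a
  time, with the remaining constraint absorbed into the ground set
  (\<open>convex_multipliers_finite\<close>).
\<close>

section \<open>Lagrange multipliers for convex inequalities\<close>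

text \<open>
  If \<open>h x > 0 > h y\<close>, the affine interpolation of \<open>h\<close> between \<open>x\<close> and \<open>y\<close> vanishes at the
  point of the segment with weights proportional to \<open>- h y\<close> and \<open>h x\<close>. Convexity puts this
  point into \<open>{h \<le> 0}\<close>, so \<open>\<phi>\<close> is nonnegative there, and convexity of \<open>\<phi>\<close> carries
  that over to the same combination of its values.
\<close>

lemma convex_crossing_inequality:
  fixes \<phi> h :: "'a::real_vector \<Rightarrow> real"
  assumes \<phi>: "convex_on C \<phi>" and h: "convex_on C h"
    and nonneg: "\<And>z. z \<in> C \<Longrightarrow> h z \<le> 0 \<Longrightarrow> \<phi> z \<ge> 0"
    and x: "x \<in> C" "h x > 0" and y: "y \<in> C" "h y < 0"
  shows "h x * \<phi> y - h y * \<phi> x \<ge> 0"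
proof -
  define d where "d = h x - h y"
  have d: "d > 0" using x y by (simp add: d_def)
  define u v where "u = h x / d" and "v = - h y / d"
  have uv: "u \<ge> 0" "v \<ge> 0" "u + v = 1"
    using x y d by (simp_all add: u_def v_def divide_nonpos_pos d_def
        diff_divide_distrib[symmetric])
  define z where "z = u *\<^sub>R y + v *\<^sub>R x"
  have z: "z \<in> C"
    unfolding z_def using convex_on_imp_convex[OF h] x y uv by (intro convexD) auto
  have "h z \<le> u * h y + v * h x"
    using h x y uv by (auto simp: convex_on_def z_def)
  also have "\<dots> = 0" by (simp add: u_def v_def)
  finally have "\<phi> z \<ge> 0" using z nonneg by blast
  also have "\<phi> z \<le> u * \<phi> y + v * \<phi> x"
    using \<phi> x y uv by (auto simp: convex_on_def z_def)
  also have "\<dots> = (h x * \<phi> y - h y * \<phi> x) / d"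
    by (simp add: u_def v_def diff_divide_distrib)
  finally show ?thesis using d by (simp add: zero_le_divide_iff)
qed

text \<open>
  A multiplier must satisfy \<open>- \<phi> x / h x \<le> \<mu>\<close> where \<open>h x > 0\<close> and
  \<open>\<mu> \<le> \<phi> y / (- h y)\<close> where \<open>h y < 0\<close>. By the previous inequality every lower bound lies
  below every upper bound. The Slater point provides an upper bound, so the infimum of the
  upper bounds is a real number; it is nonnegative since \<open>\<phi> y \<ge> 0\<close> whenever \<open>h y < 0\<close>.
\<close>

lemma convex_multiplier_single:
  fixes \<phi> h :: "'a::real_vector \<Rightarrow> real"
  assumes \<phi>: "convex_on C \<phi>" and h: "convex_on C h"
    and nonneg: "\<And>x. x \<in> C \<Longrightarrow> h x \<le> 0 \<Longrightarrow> \<phi> x \<ge> 0"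
    and slater: "x0 \<in> C" "h x0 < 0"
  shows "\<exists>\<mu>\<ge>0. \<forall>x\<in>C. \<phi> x + \<mu> * h x \<ge> 0"
proof -
  define S where "S = (\<lambda>y. \<phi> y / (- h y)) ` {y \<in> C. h y < 0}"
  have ne: "S \<noteq> {}" using slater by (auto simp: S_def)
  have S_ge_0: "s \<ge> 0" if "s \<in> S" for s
    using that nonneg by (auto simp: S_def divide_nonneg_neg)
  have bdd: "bdd_below S" using S_ge_0 by (rule bdd_belowI)
  have "\<phi> x + Inf S * h x \<ge> 0" if x: "x \<in> C" for x
  proof -
    consider "h x < 0" | "h x = 0" | "h x > 0" by linarith
    then show ?thesis
    proof cases
      case 1
      then have "Inf S \<le> \<phi> x / (- h x)"
        using x bdd by (intro cInf_lower) (auto simp: S_def)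
      then show ?thesis using 1 by (simp add: field_simps)
    next
      case 2
      then show ?thesis using nonneg x by simp
    next
      case 3
      have "- \<phi> x / h x \<le> s" if "s \<in> S" for s
      proof -
        from that obtain y where y: "y \<in> C" "h y < 0" and s: "s = \<phi> y / (- h y)"
          by (auto simp: S_def)
        have "h x * \<phi> y - h y * \<phi> x \<ge> 0"
          using convex_crossing_inequality[OF \<phi> h nonneg x 3 y] by simp
        then show ?thesis using 3 y(2) by (simp add: s field_simps)
      qed
      then have "- \<phi> x / h x \<le> Inf S" using ne by (intro cInf_greatest)
      then show ?thesis using 3 by (simp add: field_simps)
    qed
  qed
  moreover have "Inf S \<ge> 0" using ne S_ge_0 by (rule cInf_greatest)
  ultimately show ?thesis by blast
qed

text \<open>
  The ground set \<open>C\<close> varies in the induction: in the step, the new constraint \<open>h i \<le> 0\<close> first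
  shrinks \<open>C\<close>, so that the induction hypothesis handles the others; then it is the only
  constraint left, and the Lagrangian obtained so far takes the place of \<open>\<phi>\<close>.
\<close>

lemma convex_multipliers_finite:
  fixes \<phi> :: "'a::real_vector \<Rightarrow> real" and h :: "'i \<Rightarrow> 'a \<Rightarrow> real"
  assumes "finite I" and "convex_on C \<phi>" and "\<And>i. i \<in> I \<Longrightarrow> convex_on C (h i)"
    and "\<And>x. x \<in> C \<Longrightarrow> \<forall>i\<in>I. h i x \<le> 0 \<Longrightarrow> \<phi> x \<ge> 0"
    and "x0 \<in> C" and "\<And>i. i \<in> I \<Longrightarrow> h i x0 < 0"
  shows "\<exists>l. (\<forall>i\<in>I. l i \<ge> 0) \<and> (\<forall>x\<in>C. \<phi> x + (\<Sum>i\<in>I. l i * h i x) \<ge> 0)"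
  using assms
proof (induction I arbitrary: C rule: finite_induct)
  case empty
  then show ?case by simp
next
  case (insert i I)
  have hi: "convex_on C (h i)" using insert.prems by simp
  have C: "convex C" using hi by (rule convex_on_imp_convex)
  define C' where "C' = {x \<in> C. h i x \<le> 0}"
  have "C' \<subseteq> C" by (auto simp: C'_def)
  have convC': "convex C'"
  proof (rule convexI)
    fix x y and u v :: real
    assume xy: "x \<in> C'" "y \<in> C'" and uv: "0 \<le> u" "0 \<le> v" "u + v = 1"
    have "u *\<^sub>R x + v *\<^sub>R y \<in> C"
      using C xy uv by (intro convexD) (auto simp: C'_def)
    moreover have "h i (u *\<^sub>R x + v *\<^sub>R y) \<le> u * h i x + v * h i y"
      using hi xy uv by (auto simp: convex_on_def C'_def)
    moreover have "u * h i x + v * h i y \<le> 0"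
      using xy uv by (auto simp: C'_def intro!: add_nonpos_nonpos mult_nonneg_nonpos)
    ultimately show "u *\<^sub>R x + v *\<^sub>R y \<in> C'" by (auto simp: C'_def)
  qed
  have restrict: "convex_on C' k" if "convex_on C k" for k :: "'a \<Rightarrow> real"
    using that \<open>C' \<subseteq> C\<close> convC' by (rule convex_on_subset)
  have "\<exists>l. (\<forall>j\<in>I. l j \<ge> 0) \<and> (\<forall>x\<in>C'. \<phi> x + (\<Sum>j\<in>I. l j * h j x) \<ge> 0)"
  proof (rule insert.IH)
    show "convex_on C' \<phi>" using insert.prems(1) by (rule restrict)
    show "convex_on C' (h j)" if "j \<in> I" for j
      using insert.prems(2) that by (auto intro: restrict)
    show "\<phi> x \<ge> 0" if "x \<in> C'" "\<forall>j\<in>I. h j x \<le> 0" for x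
      using that insert.prems(3) by (auto simp: C'_def)
    show "x0 \<in> C'" using insert.prems(4,5) by (auto simp: C'_def less_imp_le)
    show "h j x0 < 0" if "j \<in> I" for j using insert.prems(5) that by simp
  qed
  then obtain l where l: "\<And>j. j \<in> I \<Longrightarrow> l j \<ge> 0"
    and L: "\<And>x. x \<in> C' \<Longrightarrow> \<phi> x + (\<Sum>j\<in>I. l j * h j x) \<ge> 0" by blast
  have "convex_on C (\<lambda>x. \<Sum>j\<in>I. l j * h j x)"
    using insert.hyps(1) C l insert.prems(2)
  proof (induction I rule: finite_induct)
    case empty
    then show ?case by (simp add: convex_on_def)
  next
    case (insert j J)
    then show ?case by (auto intro!: convex_on_add convex_on_cmul)
  qed
  then have "convex_on C (\<lambda>x. \<phi> x + (\<Sum>j\<in>I. l j * h j x))"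
    using insert.prems(1) by (intro convex_on_add)
  then obtain \<mu> where \<mu>: "\<mu> \<ge> 0"
    "\<And>x. x \<in> C \<Longrightarrow> \<phi> x + (\<Sum>j\<in>I. l j * h j x) + \<mu> * h i x \<ge> 0"
    using convex_multiplier_single[OF _ hi, of "\<lambda>x. \<phi> x + (\<Sum>j\<in>I. l j * h j x)" x0]
      L insert.prems(4,5) by (auto simp: C'_def)
  have "(\<Sum>j\<in>insert i I. (l(i := \<mu>)) j * h j x) = \<mu> * h i x + (\<Sum>j\<in>I. l j * h j x)" for x
    using insert.hyps by (auto intro!: sum.cong)
  then show ?case using l \<mu> by (intro exI[of _ "l(i := \<mu>)"]) (auto simp: add_ac)
qed

section \<open>The two optimal values\<close>

text \<open>
  Each feasible \<open>(s, t)\<close> is dominated by the feasible pair with the same ratio \<open>x = s / t\<close>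
  and \<open>t = 1 / g x\<close>, at which the objective is \<open>f x / g x\<close>.
\<close>

lemma CCT_inf_eq_fractional:
  fixes f g :: "real ^ 'n \<Rightarrow> real"
  assumes f: "\<And>x. x \<in> constraint_set m h \<Longrightarrow> f x \<ge> 0"
    and g: "\<And>x. x \<in> constraint_set m h \<Longrightarrow> g x > 0"
  shows "CCT_inf m f g h = (INF x\<in>constraint_set m h. ereal (f x / g x))"
  unfolding CCT_inf_def
proof (rule INF_eq, goal_cases)
  case (1 p)
  obtain s t where p: "p = (s, t)" by fastforce
  define x where "x = s /\<^sub>R t"
  have t: "t > 0" and gt: "1 \<le> t * g x" and "\<forall>i\<in>{1..m}. t * h i x \<le> 0"
    using 1 by (auto simp: p CCT_feasible_def x_def)
  then have x: "x \<in> constraint_set m h"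
    by (auto simp: constraint_set_def mult_le_0_iff)
  have "f x * 1 \<le> f x * (t * g x)" using f[OF x] gt by (intro mult_left_mono)
  then have "f x / g x \<le> t * f x" using g[OF x] by (simp add: field_simps)
  then show ?case using x by (auto simp: p x_def)
next
  case (2 x)
  define t where "t = 1 / g x"
  have t: "t > 0" using g 2 by (simp add: t_def)
  have x: "(t *\<^sub>R x) /\<^sub>R t = x" using t by simp
  have "t * g x = 1" using g[OF 2] by (simp add: t_def)
  then have "(t *\<^sub>R x, t) \<in> CCT_feasible m g h"
    using 2 t x
    by (auto simp: CCT_feasible_def constraint_set_def mult_le_0_iff)
  then show ?case using x by (intro bexI) (auto simp: t_def)
qed

lemma LD_feasible_le_quotient:
  fixes f g :: "real ^ 'n \<Rightarrow> real"
  assumes LD: "(l, \<gamma>) \<in> LD_feasible m f g h"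
    and x: "x \<in> constraint_set m h" and g: "g x > 0"
  shows "\<gamma> \<le> f x / g x"
proof -
  have "(\<Sum>i=1..m. l i * h i x) \<le> 0"
    using LD x by (intro sum_nonpos mult_nonneg_nonpos)
      (auto simp: LD_feasible_def constraint_set_def)
  moreover have "f x + (\<Sum>i=1..m. l i * h i x) - \<gamma> * g x \<ge> 0"
    using LD by (auto simp: LD_feasible_def)
  ultimately have "\<gamma> * g x \<le> f x" by linarith
  then show ?thesis using g by (simp add: field_simps)
qed

text \<open>
  A nonnegative \<open>\<gamma>\<close> keeps \<open>f - \<gamma> * g\<close> convex; a lower bound of the quotient keeps it
  nonnegative on the constraint set. So the multiplier theorem applies to it.
\<close>

lemma LD_feasible_of_lower_bound:
  fixes f g :: "real ^ 'n \<Rightarrow> real"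
  assumes f: "convex_on UNIV f" and g: "convex_on UNIV (\<lambda>x. - g x)"
    and h: "\<And>i. i \<in> {1..m} \<Longrightarrow> convex_on UNIV (h i)"
    and slater: "slater_condition m h"
    and g_pos: "\<And>x. x \<in> constraint_set m h \<Longrightarrow> g x > 0"
    and \<gamma>: "\<gamma> \<ge> 0" "\<And>x. x \<in> constraint_set m h \<Longrightarrow> \<gamma> \<le> f x / g x"
  obtains l where "(l, \<gamma>) \<in> LD_feasible m f g h"
proof -
  obtain x0 where x0: "\<And>i. i \<in> {1..m} \<Longrightarrow> h i x0 < 0"
    using slater unfolding slater_condition_def by blast
  have conv: "convex_on UNIV (\<lambda>x. f x - \<gamma> * g x)"
    using convex_on_add[OF f convex_on_cmul[OF \<gamma>(1) g]] by simp
  have nonneg: "f x - \<gamma> * g x \<ge> 0" if "\<forall>i\<in>{1..m}. h i x \<le> 0" for x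
  proof -
    have x: "x \<in> constraint_set m h" using that by (simp add: constraint_set_def)
    show ?thesis using \<gamma>(2)[OF x] g_pos[OF x] by (simp add: field_simps)
  qed
  obtain l where l: "\<forall>i\<in>{1..m}. l i \<ge> 0"
    "\<And>x. f x - \<gamma> * g x + (\<Sum>i=1..m. l i * h i x) \<ge> 0"
    using convex_multipliers_finite[of "{1..m}" _ _ h, OF _ conv h nonneg _ x0] by auto
  have "(\<Sum>i=1..m. restrict l {1..m} i * h i x) = (\<Sum>i=1..m. l i * h i x)" for x
    by (intro sum.cong) auto
  then have "(restrict l {1..m}, \<gamma>) \<in> LD_feasible m f g h"
    using l \<gamma>(1) by (auto simp: LD_feasible_def algebra_simps)
  then show ?thesis by (rule that)
qed

theorem theorem4p2:
  fixes f g :: "real ^ 'n \<Rightarrow> real"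
    and h :: "nat \<Rightarrow> real ^ 'n \<Rightarrow> real"
    and m :: nat
  assumes "convex_polynomial f"
    and "convex_polynomial (\<lambda>x. - g x)"
    and "\<forall>i\<in>{1..m}. convex_polynomial (h i)"
    and "constraint_set m h \<noteq> {}"
    and "\<forall>x\<in>constraint_set m h. f x \<ge> 0"
    and "\<forall>x\<in>constraint_set m h. g x > 0"
    and "slater_condition m h"
  shows "CCT_inf m f g h = LD_sup m f g h \<and>
    (\<exists>(l, \<gamma>)\<in>LD_feasible m f g h. ereal \<gamma> = LD_sup m f g h)"
proof -
  let ?K = "constraint_set m h"
  have f: "\<And>x. x \<in> ?K \<Longrightarrow> f x \<ge> 0" and g: "\<And>x. x \<in> ?K \<Longrightarrow> g x > 0"
    using assms(5,6) by auto
  define \<gamma>\<^sub>0 where "\<gamma>\<^sub>0 = (INF x\<in>?K. f x / g x)"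
  have quot: "f x / g x \<ge> 0" if "x \<in> ?K" for x
    using f[OF that] g[OF that] by simp
  have bdd: "bdd_below ((\<lambda>x. f x / g x) ` ?K)" using quot by (intro bdd_belowI2)
  have \<gamma>0: "\<gamma>\<^sub>0 \<ge> 0" unfolding \<gamma>\<^sub>0_def using assms(4) quot by (rule cINF_greatest)
  have lower: "\<gamma>\<^sub>0 \<le> f x / g x" if "x \<in> ?K" for x
    unfolding \<gamma>\<^sub>0_def using bdd that by (rule cINF_lower)
  have "ereal \<gamma>\<^sub>0 = (INF x\<in>?K. ereal (f x / g x))"
    using ereal_Inf'[OF bdd] assms(4) by (simp add: \<gamma>\<^sub>0_def image_image)
  then have primal: "CCT_inf m f g h = ereal \<gamma>\<^sub>0"
    using CCT_inf_eq_fractional[of m h f g, OF f g] by simp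
  obtain l where l: "(l, \<gamma>\<^sub>0) \<in> LD_feasible m f g h"
    by (rule LD_feasible_of_lower_bound[of f g m h \<gamma>\<^sub>0])
      (use assms g \<gamma>0 lower in \<open>auto simp: convex_polynomial_def\<close>)
  have "\<gamma> \<le> \<gamma>\<^sub>0" if "(l', \<gamma>) \<in> LD_feasible m f g h" for l' \<gamma>
    unfolding \<gamma>\<^sub>0_def using assms(4) LD_feasible_le_quotient[OF that _ g]
    by (intro cINF_greatest)
  then have dual: "LD_sup m f g h = ereal \<gamma>\<^sub>0"
    unfolding LD_sup_def using l by (intro antisym SUP_least SUP_upper2[of "(l, \<gamma>\<^sub>0)"]) auto
  show ?thesis using primal dual l by auto
qed

end
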